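(* Let $A\in\mathbb{R}^{m\times n}$, $b\in\mathbb{R}^m$, and let $$f(x)=\frac12\|Ax-b\|^2+\sum_{i=1}^n r(x_i),\qquad x\in\mathbb{R}^n,$$ where $r:\mathbb{R}\to\mathbb{R}$ is either the SCAD function $$r(t)=\begin{cases}\lambda|t| & \text{if } |t|\le\lambda,\\ \frac{-t^2+2\theta\lambda|t|-\lambda^2}{2(\theta-1)} & \text{if } \lambda<|t|\le\theta\lambda,\\ \frac{(\theta+1)\lambda^2}{2} & \text{if } |t|>\theta\lambda,\end{cases}$$ with $\lambda>0$ and $\theta>2$, or the MCP function $$r(t)=\begin{cases}\lambda|t|-\frac{t^2}{2\theta} & \text{if } |t|\le\theta\lambda,\\ \frac{\theta\lambda^2}{2} & \text{if } |t|>\theta\lambda,\end{cases}$$ with $\lambda>0$ and $\theta>0$. Then $f$ is a KL function with an exponent of $\frac12$.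
   Context: For a proper function $f$ and $x\in\mathrm{dom}\,f=\{x:f(x)<\infty\}$, the regular subdifferential is $\widehat\partial f(x)=\{v: \liminf_{z\to x,z\ne x}\frac{f(z)-f(x)-\langle v,z-x\rangle}{\|z-x\|}\ge 0\}$ and the (limiting) subdifferential $\partial f(x)$ is the set of $v$ for which there exist $x^t\to x$ with $f(x^t)\to f(x)$ and $v^t\to v$ with $v^t\in\widehat\partial f(x^t)$ for each $t$. $\mathrm{dom}\,\partial f=\{x:\partial f(x)\ne\emptyset\}$. A proper closed (i.e. lower semicontinuous) function $f$ has the KL property at $\bar x\in\mathrm{dom}\,\partial f$ with an exponent of $\alpha\in[0,1)$ if there exist $c,\epsilon>0$ and $\nu\in(0,\infty]$ such that $\mathrm{dist}(0,\partial f(x))\ge c\,(f(x)-f(\bar x))^\alpha$ whenever $\|x-\bar x\|\le\epsilon$ and $f(\bar x)<f(x)<f(\bar x)+\nu$ (with $\mathrm{dist}(0,\emptyset)=+\infty$). It is a KL function with an exponent of $\alpha$ if it has the KL property with exponent $\alpha$ at every $\bar x\in\mathrm{dom}\,\partial f$. *)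

theory Defs
  imports "HOL-Analysis.Analysis"
begin

definition proper_fun :: "('a \<Rightarrow> ereal) \<Rightarrow> bool" where
  "proper_fun f \<longleftrightarrow> (\<forall>x. f x \<noteq> -\<infinity>) \<and> (\<exists>x. f x < \<infinity>)"

definition closed_fun :: "('a::topological_space \<Rightarrow> ereal) \<Rightarrow> bool" where
  "closed_fun f \<longleftrightarrow> (\<forall>x. f x \<le> Liminf (at x) f)"

text \<open>Both subdifferentials are taken to be empty at points where \<open>f\<close> is not finite.
  The filter \<open>at x\<close> excludes the point \<open>x\<close> itself.\<close>

definition regular_subdiff :: "('a::euclidean_space \<Rightarrow> ereal) \<Rightarrow> 'a \<Rightarrow> 'a set" where
  "regular_subdiff f x =
     {v. \<bar>f x\<bar> \<noteq> \<infinity> \<and>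
         Liminf (at x) (\<lambda>z. (f z - f x - ereal (v \<bullet> (z - x))) / ereal (norm (z - x))) \<ge> 0}"

definition limiting_subdiff :: "('a::euclidean_space \<Rightarrow> ereal) \<Rightarrow> 'a \<Rightarrow> 'a set" where
  "limiting_subdiff f x =
     {v. \<bar>f x\<bar> \<noteq> \<infinity> \<and>
         (\<exists>xs vs. xs \<longlonglongrightarrow> x \<and> (\<lambda>t. f (xs t)) \<longlonglongrightarrow> f x \<and> vs \<longlonglongrightarrow> v \<and>
                  (\<forall>t::nat. vs t \<in> regular_subdiff f (xs t)))}"

definition dom_subdiff :: "('a::euclidean_space \<Rightarrow> ereal) \<Rightarrow> 'a set" where
  "dom_subdiff f = {x. limiting_subdiff f x \<noteq> {}}"

text \<open>Unlike \<open>infdist\<close>, which is 0 for the empty set, this distance is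
  \<open>\<infinity>\<close> for the empty set.\<close>

definition edist_set :: "'a::metric_space \<Rightarrow> 'a set \<Rightarrow> ereal" where
  "edist_set x S = (INF y\<in>S. ereal (dist x y))"

text \<open>The conversion \<open>real_of_ereal\<close> is harmless: \<open>f x\<close> and \<open>f xbar\<close> are both finite
  whenever \<open>xbar \<in> dom_subdiff f\<close> and \<open>f xbar < f x < f xbar + \<nu>\<close>.\<close>

definition KL_property_at :: "('a::euclidean_space \<Rightarrow> ereal) \<Rightarrow> real \<Rightarrow> 'a \<Rightarrow> bool" where
  "KL_property_at f \<alpha> xbar \<longleftrightarrow>
     proper_fun f \<and> closed_fun f \<and> 0 \<le> \<alpha> \<and> \<alpha> < 1 \<and> xbar \<in> dom_subdiff f \<and>
     (\<exists>c::real. \<exists>\<epsilon>::real. \<exists>\<nu>::ereal. c > 0 \<and> \<epsilon> > 0 \<and> \<nu> > 0 \<and>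
        (\<forall>x. norm (x - xbar) \<le> \<epsilon> \<and> f xbar < f x \<and> f x < f xbar + \<nu> \<longrightarrow>
             edist_set 0 (limiting_subdiff f x)
               \<ge> ereal (c * real_of_ereal (f x - f xbar) powr \<alpha>)))"

definition KL_function :: "('a::euclidean_space \<Rightarrow> ereal) \<Rightarrow> real \<Rightarrow> bool" where
  "KL_function f \<alpha> \<longleftrightarrow>
     proper_fun f \<and> closed_fun f \<and> 0 \<le> \<alpha> \<and> \<alpha> < 1 \<and>
     (\<forall>xbar\<in>dom_subdiff f. KL_property_at f \<alpha> xbar)"

definition scad :: "real \<Rightarrow> real \<Rightarrow> real \<Rightarrow> real" where
  "scad lam \<theta> t =
     (if \<bar>t\<bar> \<le> lam then lam * \<bar>t\<bar>
      else if \<bar>t\<bar> \<le> \<theta> * lam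
        then (- t\<^sup>2 + 2 * \<theta> * lam * \<bar>t\<bar> - lam\<^sup>2) / (2 * (\<theta> - 1))
      else (\<theta> + 1) * lam\<^sup>2 / 2)"

definition mcp :: "real \<Rightarrow> real \<Rightarrow> real \<Rightarrow> real" where
  "mcp lam \<theta> t =
     (if \<bar>t\<bar> \<le> \<theta> * lam then lam * \<bar>t\<bar> - t\<^sup>2 / (2 * \<theta>)
      else \<theta> * lam\<^sup>2 / 2)"

end

theory Submission
  imports Defs
begin

text \<open>
  Both penalties are continuous, are differentiable away from \<open>0\<close> with a continuous derivative,
  and coincide everywhere with one of finitely many quadratic polynomials. So, at every point
  \<open>x\<close>, the objective \<open>f\<close> equals one of finitely many (possibly indefinite) quadratic functions
  \<open>\<phi>\<close> on the whole space. The choice of \<open>\<phi>\<close> involves the support of \<open>x\<close>: the coordinates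
  outside it are projected away, so that \<open>\<nabla>\<phi>(x)\<close> vanishes there. On the support, \<open>f\<close> has
  continuous partial derivatives, so every limiting subgradient \<open>v\<close> of \<open>f\<close> at \<open>x\<close> agrees with
  \<open>\<nabla>\<phi>(x)\<close> there. Hence \<open>\<parallel>\<nabla>\<phi>(x)\<parallel> \<le> \<parallel>v\<parallel>\<close>, whatever \<open>v\<close> is in the kink directions.

  What remains is an inequality for a single quadratic function,
  \<open>\<phi>(x) - \<phi>(xbar) \<le> C \<parallel>\<nabla>\<phi>(x)\<parallel>\<^sup>2\<close> for \<open>x\<close> near \<open>xbar\<close> (lemma \<open>quadratic_lojasiewicz\<close>). It holds
  without convexity and on a full neighbourhood of \<open>xbar\<close>, so the polyhedral regions of the
  pieces never enter. A piece with \<open>\<phi>(xbar) \<noteq> f(xbar)\<close> cannot be selected near \<open>xbar\<close>, by continuity;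
  for the finitely many others the inequality carries over to \<open>f\<close>
  (lemma \<open>selection_lojasiewicz\<close>). Together this gives
  \<open>f(x) - f(xbar) \<le> C \<parallel>v\<parallel>\<^sup>2\<close> for all limiting subgradients \<open>v\<close> of \<open>f\<close> at \<open>x\<close>, which is the KL
  property with exponent \<open>1/2\<close>.
\<close>

section \<open>Quadratic functions\<close>

text \<open>The exact second-order expansion with a self-adjoint Hessian \<open>Q\<close> is basis-free and is stable
  under sums and under change of the base point.\<close>

definition quadratic_with_gradient :: "('a::real_inner \<Rightarrow> real) \<Rightarrow> ('a \<Rightarrow> 'a) \<Rightarrow> bool" where
  "quadratic_with_gradient \<phi> G \<longleftrightarrow>
     (\<exists>Q. linear Q \<and> (\<forall>x y. Q x \<bullet> y = x \<bullet> Q y) \<and>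
          (\<forall>x h. G (x + h) = G x + Q h) \<and>
          (\<forall>x h. \<phi> (x + h) = \<phi> x + G x \<bullet> h + 1 / 2 * (h \<bullet> Q h)))"

lemma quadratic_continuous:
  fixes \<phi> :: "'a::euclidean_space \<Rightarrow> real"
  assumes "quadratic_with_gradient \<phi> G"
  shows "isCont \<phi> x"
proof -
  obtain Q where lin: "linear Q" and ex: "\<And>x h. \<phi> (x + h) = \<phi> x + G x \<bullet> h + 1 / 2 * (h \<bullet> Q h)"
    using assms unfolding quadratic_with_gradient_def by blast
  define c where "c = \<phi> 0"
  have eq: "\<phi> h = c + G 0 \<bullet> h + 1 / 2 * (h \<bullet> Q h)" for h
    using ex[of 0 h] by (simp only: c_def add_0)
  have "isCont (\<lambda>h. c + G 0 \<bullet> h + 1 / 2 * (h \<bullet> Q h)) x"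
    by (intro continuous_intros linear_continuous_at) (use lin in \<open>simp add: linear_linear\<close>)
  then show ?thesis by (simp add: eq[abs_def])
qed

lemma quadratic_directional_derivative:
  assumes "quadratic_with_gradient \<phi> G"
  shows "((\<lambda>s. \<phi> (x + s *\<^sub>R e)) has_real_derivative G x \<bullet> e) (at 0)"
proof -
  obtain Q where lin: "linear Q" and ex: "\<And>x h. \<phi> (x + h) = \<phi> x + G x \<bullet> h + 1 / 2 * (h \<bullet> Q h)"
    using assms unfolding quadratic_with_gradient_def by blast
  have "((\<lambda>s. \<phi> x + s * (G x \<bullet> e) + s * s * (e \<bullet> Q e) / 2) has_real_derivative G x \<bullet> e) (at 0)"
    by (auto intro!: derivative_eq_intros)
  then show ?thesis unfolding ex by (simp add: linear_scale[OF lin] mult.assoc)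
qed

lemma quadratic_add:
  assumes "quadratic_with_gradient \<phi> G" "quadratic_with_gradient \<psi> H"
  shows "quadratic_with_gradient (\<lambda>x. \<phi> x + \<psi> x) (\<lambda>x. G x + H x)"
proof -
  obtain Q where Q: "linear Q" "\<forall>x y. Q x \<bullet> y = x \<bullet> Q y" "\<forall>x h. G (x + h) = G x + Q h"
    "\<forall>x h. \<phi> (x + h) = \<phi> x + G x \<bullet> h + 1 / 2 * (h \<bullet> Q h)"
    using assms(1) unfolding quadratic_with_gradient_def by blast
  obtain R where R: "linear R" "\<forall>x y. R x \<bullet> y = x \<bullet> R y" "\<forall>x h. H (x + h) = H x + R h"
    "\<forall>x h. \<psi> (x + h) = \<psi> x + H x \<bullet> h + 1 / 2 * (h \<bullet> R h)"
    using assms(2) unfolding quadratic_with_gradient_def by blast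
  show ?thesis unfolding quadratic_with_gradient_def
  proof (intro exI[of _ "\<lambda>x. Q x + R x"] conjI)
    show "linear (\<lambda>x. Q x + R x)" using Q(1) R(1) by (rule linear_compose_add)
    show "\<forall>x y. (Q x + R x) \<bullet> y = x \<bullet> (Q y + R y)"
      by (simp add: Q(2) R(2) inner_add_left inner_add_right)
    show "\<forall>x h. G (x + h) + H (x + h) = G x + H x + (Q h + R h)"
      by (simp add: Q(3) R(3))
    show "\<forall>x h. \<phi> (x + h) + \<psi> (x + h) =
        \<phi> x + \<psi> x + (G x + H x) \<bullet> h + 1 / 2 * (h \<bullet> (Q h + R h))"
      by (simp add: Q(4) R(4) inner_add_left inner_add_right)
  qed
qed

lemma quadratic_least_squares:
  fixes L :: "'a::euclidean_space \<Rightarrow> 'b::euclidean_space"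
  assumes L: "linear L"
  shows "quadratic_with_gradient (\<lambda>x. 1 / 2 * (norm (L x - b))\<^sup>2) (\<lambda>x. adjoint L (L x - b))"
proof -
  have adj: "linear (adjoint L)" by (rule adjoint_linear[OF L])
  have w: "adjoint L y \<bullet> x = y \<bullet> L x" for x y
    using adjoint_works[OF L, of x y] by (simp add: inner_commute)
  show ?thesis unfolding quadratic_with_gradient_def
  proof (intro exI[of _ "\<lambda>x. adjoint L (L x)"] conjI allI)
    show "linear (\<lambda>x. adjoint L (L x))"
      using linear_compose[OF L adj] by (simp add: o_def)
    show "adjoint L (L x) \<bullet> y = x \<bullet> adjoint L (L y)" for x y
      by (simp add: w adjoint_works[OF L])
    show "adjoint L (L (x + h) - b) = adjoint L (L x - b) + adjoint L (L h)" for x h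
      by (simp add: linear_add[OF L] linear_add[OF adj] linear_diff[OF adj])
    show "1 / 2 * (norm (L (x + h) - b))\<^sup>2 =
        1 / 2 * (norm (L x - b))\<^sup>2 + adjoint L (L x - b) \<bullet> h + 1 / 2 * (h \<bullet> adjoint L (L h))" for x h
    proof -
      have "L (x + h) - b = (L x - b) + L h" by (simp add: linear_add[OF L])
      then have "(norm (L (x + h) - b))\<^sup>2 =
          (norm (L x - b))\<^sup>2 + 2 * ((L x - b) \<bullet> L h) + L h \<bullet> L h"
        by (simp only: power2_norm_eq_inner inner_add_left inner_add_right)
           (simp add: inner_commute)
      then show ?thesis by (simp add: w adjoint_works[OF L])
    qed
  qed
qed

lemma quadratic_separable:
  fixes c a q :: "'n::finite \<Rightarrow> real"
  shows "quadratic_with_gradient (\<lambda>x :: real ^ 'n. \<Sum>i\<in>UNIV. c i + a i * x $ i + q i / 2 * (x $ i)\<^sup>2)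
           (\<lambda>x. \<chi> i. a i + q i * x $ i)"
  unfolding quadratic_with_gradient_def
proof (intro exI[of _ "\<lambda>x :: real ^ 'n. \<chi> i. q i * x $ i"] conjI allI)
  show "linear (\<lambda>x :: real ^ 'n. \<chi> i. q i * x $ i)"
    by (rule linearI) (simp_all add: vec_eq_iff distrib_left)
next
  fix x h :: "real ^ 'n"
  show "(\<chi> i. q i * x $ i) \<bullet> h = x \<bullet> (\<chi> i. q i * h $ i)"
    unfolding inner_vec_def by (rule sum.cong) simp_all
  show "(\<chi> i. a i + q i * (x + h) $ i) = (\<chi> i. a i + q i * x $ i) + (\<chi> i. q i * h $ i)"
    by (simp add: vec_eq_iff distrib_left)
  have "c i + a i * (x + h) $ i + q i / 2 * ((x + h) $ i)\<^sup>2 =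
      c i + a i * x $ i + q i / 2 * (x $ i)\<^sup>2 + (a i + q i * x $ i) * h $ i +
      1 / 2 * (h $ i * (q i * h $ i))" for i
    by (simp add: power2_sum) (simp add: algebra_simps power2_eq_square add_divide_distrib)
  then show "(\<Sum>i\<in>UNIV. c i + a i * (x + h) $ i + q i / 2 * ((x + h) $ i)\<^sup>2) =
      (\<Sum>i\<in>UNIV. c i + a i * x $ i + q i / 2 * (x $ i)\<^sup>2) +
      (\<chi> i. a i + q i * x $ i) \<bullet> h + 1 / 2 * (h \<bullet> (\<chi> i. q i * h $ i))"
    by (simp only: inner_vec_def inner_real_def vec_lambda_beta sum.distrib sum_distrib_left)
qed

text \<open>Decompose the gradient at the base point \<open>xbar\<close> as \<open>Q k + g0\<close> with \<open>g0\<close> orthogonal to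
  the range of the Hessian \<open>Q\<close>. If \<open>g0 \<noteq> 0\<close>, gradients are bounded away from \<open>0\<close>. Otherwise
  \<open>xbar - k\<close> is a critical point, and \<open>\<phi>\<close> differs from its critical value
  \<open>\<phi> xbar - \<kappa>\<close> by at most a multiple of \<open>\<parallel>G x\<parallel>\<^sup>2\<close>. If the critical value is above
  \<open>\<phi> xbar\<close>, then near \<open>xbar\<close> the function stays well below it, which again bounds the gradient
  from below.\<close>

lemma quadratic_lojasiewicz:
  fixes \<phi> :: "'a::euclidean_space \<Rightarrow> real"
  assumes "quadratic_with_gradient \<phi> G"
  shows "\<exists>C>0. \<forall>\<^sub>F x in nhds xbar. \<phi> x - \<phi> xbar \<le> C * (norm (G x))\<^sup>2"
proof -
  obtain Q where lin: "linear Q" and sym: "\<And>x y. Q x \<bullet> y = x \<bullet> Q y"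
    and grad: "\<And>x h. G (x + h) = G x + Q h"
    and ex: "\<And>x h. \<phi> (x + h) = \<phi> x + G x \<bullet> h + 1 / 2 * (h \<bullet> Q h)"
    using assms unfolding quadratic_with_gradient_def by blast
  have near: "\<forall>\<^sub>F x in nhds xbar. \<phi> x - \<phi> xbar < \<delta>" if "\<delta> > 0" for \<delta>
  proof -
    have "((\<lambda>x. \<phi> x - \<phi> xbar) \<longlongrightarrow> 0) (nhds xbar)"
      using quadratic_continuous[OF assms, of xbar]
      by (auto simp: continuous_within tendsto_at_iff_tendsto_nhds LIM_zero_iff)
    then show ?thesis using that by (simp add: order_tendsto_iff)
  qed
  have sub: "subspace (range Q)"
    by (intro linear_subspace_image lin) simp
  obtain g1 g0 where g1: "g1 \<in> span (range Q)"
    and g0: "\<And>w. w \<in> span (range Q) \<Longrightarrow> orthogonal g0 w" and dec: "G xbar = g1 + g0"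
    using orthogonal_subspace_decomp_exists[of "range Q" "G xbar"] by blast
  obtain k where k: "g1 = Q k"
    using g1 span_eq_iff[THEN iffD2, OF sub] by auto
  have Gx: "G x = Q (k + (x - xbar)) + g0" for x
    using grad[of xbar "x - xbar"] by (simp add: dec k linear_add[OF lin] add.commute add.left_commute)
  show ?thesis
  proof (cases "g0 = 0")
    case False
    have lower: "(norm g0)\<^sup>2 \<le> (norm (G x))\<^sup>2" for x
    proof -
      have "g0 \<bullet> Q (k + (x - xbar)) = 0"
        using g0[of "Q (k + (x - xbar))"] by (simp add: span_base orthogonal_def)
      then have "(norm (G x))\<^sup>2 = (norm (Q (k + (x - xbar))))\<^sup>2 + (norm g0)\<^sup>2"
        unfolding Gx power2_norm_eq_inner by (simp add: inner_add_left inner_add_right inner_commute)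
      then show ?thesis by simp
    qed
    show ?thesis
    proof (intro exI[of _ "1 / (norm g0)\<^sup>2"] conjI)
      show "\<forall>\<^sub>F x in nhds xbar. \<phi> x - \<phi> xbar \<le> 1 / (norm g0)\<^sup>2 * (norm (G x))\<^sup>2"
        using near[of 1, simplified]
      proof eventually_elim
        case (elim x)
        have "1 \<le> 1 / (norm g0)\<^sup>2 * (norm (G x))\<^sup>2"
          using lower[of x] False by (simp add: field_simps)
        with elim show ?case by linarith
      qed
    qed (use False in simp)
  next
    case True
    \<comment> \<open>A linear right inverse of \<open>Q\<close> on its range is bounded; it replaces the smallest nonzero
      absolute eigenvalue of \<open>Q\<close>.\<close>
    obtain R where R: "linear R" "\<And>v. v \<in> range Q \<Longrightarrow> Q (R v) = v"
      using linear_exists_right_inverse_on[OF lin subspace_UNIV] by blast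
    obtain B where B: "B > 0" "\<And>v. norm (R v) \<le> B * norm v"
      using linear_bounded_pos[OF R(1)] by blast
    define \<kappa> where "\<kappa> = 1 / 2 * (k \<bullet> Q k)"
    have main: "\<bar>\<phi> x - \<phi> xbar + \<kappa>\<bar> \<le> B / 2 * (norm (G x))\<^sup>2" for x
    proof -
      define z where "z = k + (x - xbar)"
      have Gz: "G x = Q z" using Gx[of x] True by (simp add: z_def)
      have QR: "Q (R (Q z)) = Q z" using R(2) by simp
      have "\<phi> x = \<phi> xbar + Q k \<bullet> (x - xbar) + 1 / 2 * ((x - xbar) \<bullet> Q (x - xbar))"
        using ex[of xbar "x - xbar"] True by (simp add: dec k)
      then have "\<phi> x - \<phi> xbar + \<kappa> = 1 / 2 * (z \<bullet> Q z)"
        using sym[of k "x - xbar"]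
        by (simp add: \<kappa>_def z_def linear_add[OF lin] inner_add_left inner_add_right
            inner_commute[of _ "Q k"] add_divide_distrib)
      moreover have "z \<bullet> Q z = R (Q z) \<bullet> Q z"
        using sym[of z "R (Q z)"] QR by (simp add: inner_commute)
      moreover have "\<bar>R (Q z) \<bullet> Q z\<bar> \<le> B * (norm (Q z))\<^sup>2"
      proof -
        have "\<bar>R (Q z) \<bullet> Q z\<bar> \<le> norm (R (Q z)) * norm (Q z)"
          by (rule Cauchy_Schwarz_ineq2)
        also have "\<dots> \<le> (B * norm (Q z)) * norm (Q z)"
          using B(2) by (rule mult_right_mono) simp
        finally show ?thesis by (simp add: power2_eq_square mult.assoc)
      qed
      ultimately show ?thesis unfolding Gz by linarith
    qed
    show ?thesis
    proof (intro exI[of _ "B / 2"] conjI)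
      show "\<forall>\<^sub>F x in nhds xbar. \<phi> x - \<phi> xbar \<le> B / 2 * (norm (G x))\<^sup>2"
      proof (cases "\<kappa> \<ge> 0")
        case True
        then show ?thesis using main by (intro always_eventually allI) (smt (verit))
      next
        case False
        then have "\<forall>\<^sub>F x in nhds xbar. \<phi> x - \<phi> xbar < - \<kappa> / 2"
          by (intro near) simp
        then show ?thesis
        proof eventually_elim
          case (elim x)
          then show ?case using main[of x] by linarith
        qed
      qed
    qed (use B in simp)
  qed
qed

section \<open>Finite selections of quadratic functions\<close>

text \<open>Stating \<open>F x = \<phi> k x\<close> pointwise, under the quantifier over \<open>x\<close>, lets a piece be active on
  an arbitrary set. If \<open>\<phi> k xbar \<noteq> F xbar\<close>, continuity keeps the two apart near \<open>xbar\<close> and the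
  implication is vacuous there.\<close>

lemma selection_lojasiewicz:
  fixes F :: "'a::euclidean_space \<Rightarrow> real" and \<phi> :: "'k \<Rightarrow> 'a \<Rightarrow> real"
  assumes "finite K" and quad: "\<And>k. k \<in> K \<Longrightarrow> quadratic_with_gradient (\<phi> k) (G k)"
    and cont: "isCont F xbar"
  shows "\<exists>C>0. \<forall>\<^sub>F x in nhds xbar. \<forall>k\<in>K. F x = \<phi> k x \<longrightarrow> F x - F xbar \<le> C * (norm (G k x))\<^sup>2"
proof -
  have "\<exists>C>0. \<forall>\<^sub>F x in nhds xbar. F x = \<phi> k x \<longrightarrow> F x - F xbar \<le> C * (norm (G k x))\<^sup>2"
    if k: "k \<in> K" for k
  proof (cases "F xbar = \<phi> k xbar")
    case True
    obtain C where "C > 0" "\<forall>\<^sub>F x in nhds xbar. \<phi> k x - \<phi> k xbar \<le> C * (norm (G k x))\<^sup>2"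
      using quadratic_lojasiewicz[OF quad[OF k]] by blast
    then show ?thesis using True by (auto elim!: eventually_mono)
  next
    case False
    have "isCont (\<lambda>x. F x - \<phi> k x) xbar"
      by (intro continuous_intros cont quadratic_continuous[OF quad[OF k]])
    then have "((\<lambda>x. F x - \<phi> k x) \<longlongrightarrow> F xbar - \<phi> k xbar) (nhds xbar)"
      unfolding isCont_def by (rule tendsto_at_iff_tendsto_nhds[THEN iffD1])
    then have "\<forall>\<^sub>F x in nhds xbar. F x - \<phi> k x \<noteq> 0"
      using False by (intro tendsto_imp_eventually_ne) auto
    then show ?thesis by (intro exI[of _ 1]) (auto elim!: eventually_mono)
  qed
  then have "\<forall>k\<in>K. \<exists>C. C > 0 \<and>
      (\<forall>\<^sub>F x in nhds xbar. F x = \<phi> k x \<longrightarrow> F x - F xbar \<le> C * (norm (G k x))\<^sup>2)"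
    by blast
  from bchoice[OF this] obtain C where C: "\<And>k. k \<in> K \<Longrightarrow> C k > 0"
    "\<And>k. k \<in> K \<Longrightarrow> \<forall>\<^sub>F x in nhds xbar. F x = \<phi> k x \<longrightarrow> F x - F xbar \<le> C k * (norm (G k x))\<^sup>2"
    by blast
  define D where "D = 1 + sum C K"
  have le_D: "C k \<le> D" if "k \<in> K" for k
    using member_le_sum[of k K C] that C(1) \<open>finite K\<close> by (force simp: D_def intro: less_imp_le)
  have "D > 0" using C(1) by (simp add: D_def add_pos_nonneg sum_nonneg less_imp_le)
  have "\<forall>\<^sub>F x in nhds xbar. \<forall>k\<in>K. F x = \<phi> k x \<longrightarrow> F x - F xbar \<le> C k * (norm (G k x))\<^sup>2"
    using C(2) \<open>finite K\<close> by (simp add: eventually_ball_finite)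
  then have "\<forall>\<^sub>F x in nhds xbar. \<forall>k\<in>K. F x = \<phi> k x \<longrightarrow> F x - F xbar \<le> D * (norm (G k x))\<^sup>2"
  proof eventually_elim
    case (elim x)
    have "C k * (norm (G k x))\<^sup>2 \<le> D * (norm (G k x))\<^sup>2" if "k \<in> K" for k
      using le_D[OF that] by (rule mult_right_mono) simp
    with elim show ?case using order_trans by blast
  qed
  with \<open>D > 0\<close> show ?thesis by blast
qed

section \<open>Subgradients and partial derivatives\<close>

text \<open>Restricting the limit inferior to the ray \<open>y + s e\<close> with \<open>s \<down> 0\<close> turns the difference
  quotient into \<open>(D - v \<bullet> e) / \<parallel>e\<parallel>\<close>.\<close>

lemma regular_subdiff_le_directional_derivative:
  fixes f :: "'a::euclidean_space \<Rightarrow> real"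
  assumes v: "v \<in> regular_subdiff (\<lambda>x. ereal (f x)) y" and "e \<noteq> 0"
    and D: "((\<lambda>s. f (y + s *\<^sub>R e)) has_real_derivative D) (at 0)"
  shows "v \<bullet> e \<le> D"
proof -
  let ?q = "\<lambda>s. (f (y + s *\<^sub>R e) - f y) / s"
  have lim: "((\<lambda>s. (?q s - v \<bullet> e) / norm e) \<longlongrightarrow> (D - v \<bullet> e) / norm e) (at_right 0)"
  proof (intro tendsto_intros)
    show "(?q \<longlongrightarrow> D) (at_right 0)"
      using D unfolding DERIV_def by (auto intro: tendsto_within_subset)
  qed (use \<open>e \<noteq> 0\<close> in simp)
  have path: "filterlim (\<lambda>s. y + s *\<^sub>R e) (at y) (at_right 0)"
  proof (intro filterlim_atI)
    have "((\<lambda>s. y + s *\<^sub>R e) \<longlongrightarrow> y + 0 *\<^sub>R e) (at_right 0)" by (intro tendsto_intros)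
    then show "((\<lambda>s. y + s *\<^sub>R e) \<longlongrightarrow> y) (at_right 0)" by simp
    show "\<forall>\<^sub>F s in at_right 0. y + s *\<^sub>R e \<noteq> y"
      using eventually_at_right_less[of 0] by eventually_elim (use \<open>e \<noteq> 0\<close> in auto)
  qed
  have "c \<le> (D - v \<bullet> e) / norm e" if "c < 0" for c
  proof (rule tendsto_lowerbound[OF lim])
    let ?F = "\<lambda>z. (ereal (f z) - ereal (f y) - ereal (v \<bullet> (z - y))) / ereal (norm (z - y))"
    have "ereal c < Liminf (at y) ?F"
      using v that unfolding regular_subdiff_def
      by (auto intro: less_le_trans[of _ 0])
    then have "\<forall>\<^sub>F z in at y. ereal c < ?F z" by (rule less_LiminfD)
    then have "\<forall>\<^sub>F s in at_right 0. ereal c < ?F (y + s *\<^sub>R e)"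
      using path by (rule eventually_compose_filterlim)
    then show "\<forall>\<^sub>F s in at_right 0. c \<le> (?q s - v \<bullet> e) / norm e"
      using eventually_at_right_less[of 0]
    proof eventually_elim
      case (elim s)
      have "?F (y + s *\<^sub>R e) = ereal ((f (y + s *\<^sub>R e) - f y - s * (v \<bullet> e)) / (s * norm e))"
        using elim \<open>e \<noteq> 0\<close> by simp
      also have "(f (y + s *\<^sub>R e) - f y - s * (v \<bullet> e)) / (s * norm e) = (?q s - v \<bullet> e) / norm e"
        using elim \<open>e \<noteq> 0\<close> by (simp add: field_simps)
      finally show ?case using elim(1) by simp
    qed
  qed simp
  then have "0 \<le> (D - v \<bullet> e) / norm e" by (rule dense_le)
  then show ?thesis using \<open>e \<noteq> 0\<close> by (simp add: zero_le_divide_iff)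
qed

lemma regular_subdiff_directional_derivative:
  fixes f :: "'a::euclidean_space \<Rightarrow> real"
  assumes v: "v \<in> regular_subdiff (\<lambda>x. ereal (f x)) y" and e: "e \<noteq> 0"
    and D: "((\<lambda>s. f (y + s *\<^sub>R e)) has_real_derivative D) (at 0)"
  shows "v \<bullet> e = D"
proof (rule antisym)
  show "v \<bullet> e \<le> D" by (rule regular_subdiff_le_directional_derivative[OF v e D])
  have "((\<lambda>s. f (y + (- s) *\<^sub>R e)) has_real_derivative D * (- 1)) (at 0)"
    by (rule DERIV_chain2[where f = "\<lambda>s. f (y + s *\<^sub>R e)"]) (use D in \<open>auto intro!: derivative_eq_intros\<close>)
  then have "v \<bullet> (- e) \<le> - D"
    using e by (intro regular_subdiff_le_directional_derivative[OF v]) auto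
  then show "D \<le> v \<bullet> e" by simp
qed

text \<open>Differentiability along the single direction \<open>e\<close> is enough, so this applies at the kinks
  that \<open>f\<close> may have in other directions.\<close>

lemma limiting_subdiff_directional_derivative:
  fixes f :: "'a::euclidean_space \<Rightarrow> real"
  assumes v: "v \<in> limiting_subdiff (\<lambda>x. ereal (f x)) x" and e: "e \<noteq> 0"
    and D: "\<forall>\<^sub>F y in nhds x. ((\<lambda>s. f (y + s *\<^sub>R e)) has_real_derivative D y) (at 0)"
    and cont: "isCont D x"
  shows "v \<bullet> e = D x"
proof -
  obtain xs vs where xs: "xs \<longlonglongrightarrow> x" and vs: "vs \<longlonglongrightarrow> v"
    and reg: "\<And>t. vs t \<in> regular_subdiff (\<lambda>x. ereal (f x)) (xs t)"
    using v unfolding limiting_subdiff_def by blast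
  have "\<forall>\<^sub>F t in sequentially. ((\<lambda>s. f (xs t + s *\<^sub>R e)) has_real_derivative D (xs t)) (at 0)"
    using D xs by (rule eventually_compose_filterlim)
  then have "\<forall>\<^sub>F t in sequentially. D (xs t) = vs t \<bullet> e"
    by eventually_elim (use regular_subdiff_directional_derivative[OF reg e] in simp)
  moreover have "(\<lambda>t. D (xs t)) \<longlonglongrightarrow> D x"
    using cont xs by (rule isCont_tendsto_compose)
  ultimately have "(\<lambda>t. vs t \<bullet> e) \<longlonglongrightarrow> D x"
    by (rule Lim_transform_eventually[rotated])
  moreover have "(\<lambda>t. vs t \<bullet> e) \<longlonglongrightarrow> v \<bullet> e" by (intro tendsto_intros vs)
  ultimately show ?thesis by (rule LIMSEQ_unique[rotated])
qed

section \<open>From a Lojasiewicz inequality to the KL property\<close>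

lemma KL_function_half_of_lojasiewicz:
  fixes f :: "'a::euclidean_space \<Rightarrow> real"
  assumes cont: "\<And>x. isCont f x"
    and loj: "\<And>xbar. \<exists>C>0. \<forall>\<^sub>F x in nhds xbar.
                \<forall>v\<in>limiting_subdiff (\<lambda>x. ereal (f x)) x. f x - f xbar \<le> C * (norm v)\<^sup>2"
  shows "KL_function (\<lambda>x. ereal (f x)) (1 / 2)"
proof -
  let ?f = "\<lambda>x. ereal (f x)"
  have proper: "proper_fun ?f" by (simp add: proper_fun_def)
  have closed: "closed_fun ?f" unfolding closed_fun_def
  proof
    fix x
    have "((\<lambda>x. ereal (f x)) \<longlongrightarrow> ereal (f x)) (at x)"
      using cont[of x] by (simp add: isCont_def)
    then have "Liminf (at x) ?f = ?f x" by (rule lim_imp_Liminf[rotated]) simp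
    then show "?f x \<le> Liminf (at x) ?f" by simp
  qed
  have "KL_property_at ?f (1 / 2) xbar" if xbar: "xbar \<in> dom_subdiff ?f" for xbar
  proof -
    obtain C where "C > 0" and ev: "\<forall>\<^sub>F x in nhds xbar.
        \<forall>v\<in>limiting_subdiff ?f x. f x - f xbar \<le> C * (norm v)\<^sup>2"
      using loj by blast
    obtain d where "d > 0" and d: "\<And>x v. dist x xbar < d \<Longrightarrow> v \<in> limiting_subdiff ?f x \<Longrightarrow>
        f x - f xbar \<le> C * (norm v)\<^sup>2"
      using ev unfolding eventually_nhds_metric by blast
    have est: "ereal (1 / sqrt C * real_of_ereal (?f x - ?f xbar) powr (1 / 2))
        \<le> edist_set 0 (limiting_subdiff ?f x)"
      if x: "norm (x - xbar) \<le> d / 2" "?f xbar < ?f x" for x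
      unfolding edist_set_def
    proof (rule INF_greatest)
      fix v assume "v \<in> limiting_subdiff ?f x"
      then have "f x - f xbar \<le> C * (norm v)\<^sup>2"
        using d[of x v] x \<open>d > 0\<close> by (simp add: dist_norm)
      then have "sqrt (f x - f xbar) \<le> sqrt C * norm v"
        using real_sqrt_le_mono by (fastforce simp: real_sqrt_mult)
      then show "ereal (1 / sqrt C * real_of_ereal (?f x - ?f xbar) powr (1 / 2)) \<le> ereal (dist 0 v)"
        using x \<open>C > 0\<close> by (simp add: powr_half_sqrt field_simps)
    qed
    show ?thesis unfolding KL_property_at_def
      by (intro conjI proper closed xbar exI[of _ "1 / sqrt C"] exI[of _ "d / 2"] exI[of _ \<infinity>])
         (use \<open>C > 0\<close> \<open>d > 0\<close> est in auto)
  qed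
  then show ?thesis using proper closed by (simp add: KL_function_def)
qed

section \<open>Penalized least squares\<close>

text \<open>A triple \<open>(c, a, q)\<close> stands for the polynomial \<open>c + a t + q t\<^sup>2 / 2\<close>. In a
  coordinate where \<open>x\<close> vanishes, a possible kink of \<open>r\<close> at \<open>0\<close> is bypassed: the constant piece
  \<open>(r 0, 0, 0)\<close> together with the projection makes that component of the gradient zero.\<close>

theorem penalized_least_squares_KL_half:
  fixes A :: "real ^ 'n ^ 'm" and b :: "real ^ 'm" and r r' :: "real \<Rightarrow> real"
    and P :: "(real \<times> real \<times> real) set"
  assumes cont: "\<And>t. isCont r t"
    and deriv: "\<And>t. t \<noteq> 0 \<Longrightarrow> (r has_real_derivative r' t) (at t)"
    and cont': "\<And>t. t \<noteq> 0 \<Longrightarrow> isCont r' t"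
    and "finite P"
    and pieces: "\<And>t. t \<noteq> 0 \<Longrightarrow>
       \<exists>(c, a, q)\<in>P. r t = c + a * t + q / 2 * t\<^sup>2 \<and> r' t = a + q * t"
  shows "KL_function (\<lambda>x. ereal (1 / 2 * (norm (A *v x - b))\<^sup>2 + (\<Sum>i\<in>UNIV. r (x $ i)))) (1 / 2)"
proof (rule KL_function_half_of_lojasiewicz)
  let ?f = "\<lambda>x. 1 / 2 * (norm (A *v x - b))\<^sup>2 + (\<Sum>i\<in>UNIV. r (x $ i))"
  define D where "D i x = (A *v x - b) \<bullet> (A *v axis i 1) + r' (x $ i)" for i x
  have linA: "linear ((*v) A)" by (rule matrix_vector_mul_linear)
  have contA: "isCont ((*v) A) x" for x
    using linA by (simp add: linear_continuous_at linear_linear)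
  show cont_f: "isCont ?f x" for x
    by (intro continuous_intros contA isCont_o2[OF _ cont])
  have partial: "v $ i = D i x"
    if v: "v \<in> limiting_subdiff (\<lambda>x. ereal (?f x)) x" and xi: "x $ i \<noteq> 0" for v x i
  proof -
    have "v \<bullet> axis i 1 = D i x"
    proof (rule limiting_subdiff_directional_derivative[OF v])
      show "isCont (D i) x" unfolding D_def
        by (intro continuous_intros contA isCont_o2[OF _ cont'] xi)
      have "((\<lambda>y. y $ i) \<longlongrightarrow> x $ i) (nhds x)"
        by (intro tendsto_intros) (simp add: filterlim_ident)
      then have "\<forall>\<^sub>F y in nhds x. y $ i \<noteq> 0"
        using xi by (rule tendsto_imp_eventually_ne)
      then show "\<forall>\<^sub>F y in nhds x. ((\<lambda>s. ?f (y + s *\<^sub>R axis i 1)) has_real_derivative D i y) (at 0)"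
      proof eventually_elim
        case (elim y)
        have "((\<lambda>s. r ((y + s *\<^sub>R axis i 1) $ j)) has_real_derivative
            (if j = i then r' (y $ i) else 0)) (at 0)" for j
        proof (cases "j = i")
          case True
          have "((\<lambda>s. r (y $ i + s)) has_real_derivative r' (y $ i) * 1) (at 0)"
            by (rule DERIV_chain2[where f = r]) (use deriv elim in \<open>auto intro!: derivative_eq_intros\<close>)
          then show ?thesis using True by simp
        qed (simp add: axis_def)
        then have "((\<lambda>s. \<Sum>j\<in>UNIV. r ((y + s *\<^sub>R axis i 1) $ j)) has_real_derivative
            (\<Sum>j\<in>UNIV. if j = i then r' (y $ i) else 0)) (at 0)"
          by (intro DERIV_sum)
        then have sep: "((\<lambda>s. \<Sum>j\<in>UNIV. r ((y + s *\<^sub>R axis i 1) $ j)) has_real_derivative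
            r' (y $ i)) (at 0)" by simp
        have "((\<lambda>s. 1 / 2 * (norm (A *v (y + s *\<^sub>R axis i 1) - b))\<^sup>2) has_real_derivative
            (A *v y - b) \<bullet> (A *v axis i 1)) (at 0)"
          using quadratic_directional_derivative[OF quadratic_least_squares[OF linA, of b], of y "axis i 1"]
          by (simp add: inner_commute[of "adjoint _ _"] adjoint_works[OF linA] inner_commute)
        from DERIV_add[OF this sep] show ?case unfolding D_def .
      qed
    qed (simp add: axis_eq_0_iff)
    then show ?thesis by (simp add: inner_axis)
  qed
  define proj where "proj I x = (\<chi> i. if i \<in> I then x $ i else 0)" for I and x :: "real ^ 'n"
  have lin_proj: "linear (\<lambda>x. A *v proj I x)" for I
  proof -
    have "linear (proj I)"
      by (rule linearI) (simp_all add: proj_def vec_eq_iff)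
    from linear_compose[OF this linA] show ?thesis by (simp add: o_def)
  qed
  define \<phi> :: "('n set \<times> ('n \<Rightarrow> real \<times> real \<times> real)) \<Rightarrow> real ^ 'n \<Rightarrow> real"
    where "\<phi> = (\<lambda>(I, p) x. 1 / 2 * (norm (A *v proj I x - b))\<^sup>2 +
      (\<Sum>i\<in>UNIV. fst (p i) + fst (snd (p i)) * x $ i + snd (snd (p i)) / 2 * (x $ i)\<^sup>2))"
  define G :: "('n set \<times> ('n \<Rightarrow> real \<times> real \<times> real)) \<Rightarrow> real ^ 'n \<Rightarrow> real ^ 'n"
    where "G = (\<lambda>(I, p) x. adjoint (\<lambda>x. A *v proj I x) (A *v proj I x - b) +
      (\<chi> i. fst (snd (p i)) + snd (snd (p i)) * x $ i))"
  define K where "K = (UNIV :: 'n set set) \<times> (\<Pi>\<^sub>E i\<in>(UNIV :: 'n set). insert (r 0, 0, 0) P)"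
  have "finite K" using \<open>finite P\<close> unfolding K_def by (intro finite_cartesian_product finite_PiE) simp_all
  have quad: "quadratic_with_gradient (\<phi> k) (G k)" for k
    unfolding \<phi>_def G_def
    by (cases k) (simp only: prod.case, intro quadratic_add quadratic_least_squares[OF lin_proj] quadratic_separable)
  have select: "\<exists>k\<in>K. ?f x = \<phi> k x \<and>
      (\<forall>v\<in>limiting_subdiff (\<lambda>x. ereal (?f x)) x. norm (G k x) \<le> norm v)" for x
  proof -
    define I where "I = {i. x $ i \<noteq> 0}"
    have "\<forall>t. \<exists>p. t \<noteq> 0 \<longrightarrow> p \<in> P \<and>
        r t = fst p + fst (snd p) * t + snd (snd p) / 2 * t\<^sup>2 \<and> r' t = fst (snd p) + snd (snd p) * t"
      using pieces unfolding split_beta by blast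
    from choice[OF this] obtain piece where piece: "\<And>t. t \<noteq> 0 \<Longrightarrow> piece t \<in> P \<and>
        r t = fst (piece t) + fst (snd (piece t)) * t + snd (snd (piece t)) / 2 * t\<^sup>2 \<and>
        r' t = fst (snd (piece t)) + snd (snd (piece t)) * t"
      by blast
    define p where "p i = (if i \<in> I then piece (x $ i) else (r 0, 0, 0))" for i
    have "(I, p) \<in> K" using piece by (auto simp: K_def p_def I_def)
    moreover have proj_x: "proj I x = x" by (simp add: proj_def I_def vec_eq_iff)
    moreover have "r (x $ i) = fst (p i) + fst (snd (p i)) * x $ i + snd (snd (p i)) / 2 * (x $ i)\<^sup>2" for i
      using piece by (auto simp: p_def I_def)
    moreover have "norm (G (I, p) x) \<le> norm v"
      if v: "v \<in> limiting_subdiff (\<lambda>x. ereal (?f x)) x" for v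
    proof (rule norm_le_componentwise_cart)
      fix i
      have adj: "adjoint (\<lambda>x. A *v proj I x) y $ i = y \<bullet> (A *v proj I (axis i 1))" for y
        using adjoint_works[OF lin_proj, of "axis i 1" I y]
        by (simp add: inner_axis' inner_commute)
      show "norm (G (I, p) x $ i) \<le> norm (v $ i)"
      proof (cases "i \<in> I")
        case True
        then have "proj I (axis i 1) = axis i 1" by (auto simp: proj_def axis_def vec_eq_iff)
        moreover have xi: "x $ i \<noteq> 0" using True by (simp add: I_def)
        ultimately have "G (I, p) x $ i = D i x"
          using True piece[OF xi] by (simp add: G_def D_def adj proj_x p_def)
        then show ?thesis using partial[OF v xi] by simp
      next
        case False
        then have "proj I (axis i 1) = 0" by (auto simp: proj_def axis_def vec_eq_iff)
        then have "G (I, p) x $ i = 0" using False by (simp add: G_def adj p_def)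
        then show ?thesis by simp
      qed
    qed
    ultimately show ?thesis by (intro bexI[of _ "(I, p)"]) (simp_all add: \<phi>_def)
  qed
  fix xbar
  obtain C where "C > 0" and C: "\<forall>\<^sub>F x in nhds xbar. \<forall>k\<in>K. ?f x = \<phi> k x \<longrightarrow>
      ?f x - ?f xbar \<le> C * (norm (G k x))\<^sup>2"
    using selection_lojasiewicz[where F = ?f and \<phi> = \<phi> and G = G, OF \<open>finite K\<close> quad cont_f] by blast
  have "\<forall>\<^sub>F x in nhds xbar. \<forall>v\<in>limiting_subdiff (\<lambda>x. ereal (?f x)) x.
      ?f x - ?f xbar \<le> C * (norm v)\<^sup>2"
    using C
  proof eventually_elim
    case (elim x)
    obtain k where k: "k \<in> K" "?f x = \<phi> k x"
        "\<And>v. v \<in> limiting_subdiff (\<lambda>x. ereal (?f x)) x \<Longrightarrow> norm (G k x) \<le> norm v"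
      using select[of x] by blast
    show ?case
    proof
      fix v assume "v \<in> limiting_subdiff (\<lambda>x. ereal (?f x)) x"
      then have "C * (norm (G k x))\<^sup>2 \<le> C * (norm v)\<^sup>2"
        using k(3) \<open>C > 0\<close> by (simp add: power_mono)
      moreover have "?f x - ?f xbar \<le> C * (norm (G k x))\<^sup>2"
        using elim k(1,2) by blast
      ultimately show "?f x - ?f xbar \<le> C * (norm v)\<^sup>2" by linarith
    qed
  qed
  then show "\<exists>C>0. \<forall>\<^sub>F x in nhds xbar. \<forall>v\<in>limiting_subdiff (\<lambda>x. ereal (?f x)) x.
      ?f x - ?f xbar \<le> C * (norm v)\<^sup>2"
    using \<open>C > 0\<close> by blast
qed

section \<open>The SCAD and MCP penalties\<close>

text \<open>SCAD and MCP share one form: a quadratic bend of \<open>lam * \<bar>t\<bar>\<close> that starts at \<open>\<beta>\<close>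
  and is undone from \<open>\<gamma>\<close> on; both have \<open>lam = 2 * \<alpha> * (\<gamma> - \<beta>)\<close>, hence are flat beyond \<open>\<gamma>\<close>.
  In this form differentiability at the breakpoints is that of a squared positive part.\<close>

definition folded_penalty :: "real \<Rightarrow> real \<Rightarrow> real \<Rightarrow> real \<Rightarrow> real \<Rightarrow> real" where
  "folded_penalty lam \<alpha> \<beta> \<gamma> t =
     lam * \<bar>t\<bar> - \<alpha> * ((max 0 (\<bar>t\<bar> - \<beta>))\<^sup>2 - (max 0 (\<bar>t\<bar> - \<gamma>))\<^sup>2)"

definition folded_penalty_deriv :: "real \<Rightarrow> real \<Rightarrow> real \<Rightarrow> real \<Rightarrow> real \<Rightarrow> real" where
  "folded_penalty_deriv lam \<alpha> \<beta> \<gamma> t =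
     sgn t * (lam - 2 * \<alpha> * (max 0 (\<bar>t\<bar> - \<beta>) - max 0 (\<bar>t\<bar> - \<gamma>)))"

lemma scad_eq_folded_penalty:
  assumes "lam > 0" "\<theta> > 2"
  shows "scad lam \<theta> = folded_penalty lam (1 / (2 * (\<theta> - 1))) lam (\<theta> * lam)"
proof
  fix t :: real
  define k where "k = 2 * (\<theta> - 1)"
  have "k > 0" and \<theta>: "\<theta> = 1 + k / 2" using assms by (simp_all add: k_def field_simps)
  have le: "lam \<le> \<theta> * lam" using assms by simp
  have mid: "(- \<bar>t\<bar>\<^sup>2 + 2 * \<theta> * lam * \<bar>t\<bar> - lam\<^sup>2) / k = lam * \<bar>t\<bar> - 1 / k * (\<bar>t\<bar> - lam)\<^sup>2"
    using \<open>k > 0\<close> by (simp only: \<theta>) (simp add: field_simps power2_diff power2_eq_square[of lam])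
  have out: "(\<theta> + 1) * lam\<^sup>2 / 2 =
      lam * \<bar>t\<bar> - 1 / k * ((\<bar>t\<bar> - lam)\<^sup>2 - (\<bar>t\<bar> - \<theta> * lam)\<^sup>2)"
    using \<open>k > 0\<close> by (simp only: \<theta>) (simp add: field_simps power2_eq_square)
  show "scad lam \<theta> t = folded_penalty lam (1 / (2 * (\<theta> - 1))) lam (\<theta> * lam) t"
    unfolding scad_def folded_penalty_def k_def[symmetric]
    using le mid out by auto
qed

lemma mcp_eq_folded_penalty:
  assumes "lam > 0" "\<theta> > 0"
  shows "mcp lam \<theta> = folded_penalty lam (1 / (2 * \<theta>)) 0 (\<theta> * lam)"
proof
  fix t :: real
  have "\<theta> * lam\<^sup>2 / 2 =
      lam * \<bar>t\<bar> - 1 / (2 * \<theta>) * (\<bar>t\<bar>\<^sup>2 - (\<bar>t\<bar> - \<theta> * lam)\<^sup>2)"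
    using assms by (simp add: field_simps power2_diff power_mult_distrib) (simp add: power2_eq_square)
  then show "mcp lam \<theta> t = folded_penalty lam (1 / (2 * \<theta>)) 0 (\<theta> * lam) t"
    by (auto simp: mcp_def folded_penalty_def)
qed

lemma DERIV_max_0_squared: "((\<lambda>s. (max 0 s)\<^sup>2) has_real_derivative 2 * max 0 s) (at (s :: real))"
proof -
  have "((\<lambda>h. ((max 0 (s + h))\<^sup>2 - (max 0 s)\<^sup>2) / h - 2 * max 0 s) \<longlongrightarrow> 0) (at 0)"
  proof (rule Lim_null_comparison)
    show "\<forall>\<^sub>F h in at 0. norm (((max 0 (s + h))\<^sup>2 - (max 0 s)\<^sup>2) / h - 2 * max 0 s) \<le> \<bar>h\<bar>"
      unfolding eventually_at_filter real_norm_def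
    proof (intro always_eventually allI impI)
      fix h :: real assume "h \<noteq> 0"
      have "\<bar>(max 0 (s + h))\<^sup>2 - (max 0 s)\<^sup>2 - 2 * max 0 s * h\<bar> \<le> h\<^sup>2"
      proof -
        consider "s \<ge> 0" "s + h \<ge> 0" | "s \<ge> 0" "s + h < 0" | "s < 0" "s + h \<ge> 0" | "s < 0" "s + h < 0"
          by linarith
        then show ?thesis
        proof cases
          case 2
          have "(s + h)\<^sup>2 \<ge> 0" "s * (s + h) \<le> 0" "s * s \<ge> 0" "s * h \<le> 0"
            using 2 by (simp_all add: mult_nonneg_nonpos)
          then show ?thesis using 2 by (simp add: max_def abs_le_iff power2_eq_square algebra_simps)
        next
          case 3
          then have "(s + h)\<^sup>2 \<le> h\<^sup>2" by (intro power_mono) auto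
          then show ?thesis using 3 by (simp add: max_def)
        qed (auto simp: max_def power2_eq_square algebra_simps)
      qed
      moreover have "((max 0 (s + h))\<^sup>2 - (max 0 s)\<^sup>2) / h - 2 * max 0 s =
          ((max 0 (s + h))\<^sup>2 - (max 0 s)\<^sup>2 - 2 * max 0 s * h) / h"
        using \<open>h \<noteq> 0\<close> by (simp add: field_simps)
      ultimately show "\<bar>((max 0 (s + h))\<^sup>2 - (max 0 s)\<^sup>2) / h - 2 * max 0 s\<bar> \<le> \<bar>h\<bar>"
        using \<open>h \<noteq> 0\<close> by (simp add: pos_divide_le_eq power2_eq_square flip: abs_mult)
    qed
    show "((\<lambda>h::real. \<bar>h\<bar>) \<longlongrightarrow> 0) (at 0)" by (rule tendsto_rabs_zero) (rule tendsto_ident_at)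
  qed
  then show ?thesis unfolding DERIV_def by (simp add: LIM_zero_iff)
qed

lemma folded_penalty_has_derivative:
  assumes "t \<noteq> 0"
  shows "(folded_penalty lam \<alpha> \<beta> \<gamma> has_real_derivative folded_penalty_deriv lam \<alpha> \<beta> \<gamma> t) (at t)"
proof -
  have abs: "(abs has_real_derivative sgn t) (at t)"
  proof (rule has_field_derivative_transform_within_open)
    show "((\<lambda>s. sgn t * s) has_real_derivative sgn t) (at t)"
      by (auto intro!: derivative_eq_intros)
    show "open {s. 0 < sgn t * s}" by (intro open_Collect_less continuous_intros)
    show "t \<in> {s. 0 < sgn t * s}" using assms by (simp add: sgn_if)
    show "sgn t * s = \<bar>s\<bar>" if "s \<in> {s. 0 < sgn t * s}" for s
      using that by (auto simp: sgn_if split: if_splits)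
  qed
  have sq: "((\<lambda>t. (max 0 (\<bar>t\<bar> - \<delta>))\<^sup>2) has_real_derivative 2 * max 0 (\<bar>t\<bar> - \<delta>) * sgn t) (at t)" for \<delta>
    by (rule DERIV_chain2[where g = "\<lambda>t. \<bar>t\<bar> - \<delta>", OF DERIV_max_0_squared])
       (auto intro!: derivative_eq_intros abs)
  show ?thesis
    unfolding folded_penalty_def[abs_def] folded_penalty_deriv_def
    by (rule derivative_eq_intros sq abs refl)+ (simp add: algebra_simps)
qed

lemma folded_penalty_KL_half:
  fixes A :: "real ^ 'n ^ 'm" and b :: "real ^ 'm"
  shows "KL_function (\<lambda>x. ereal (1 / 2 * (norm (A *v x - b))\<^sup>2 +
           (\<Sum>i\<in>UNIV. folded_penalty lam \<alpha> \<beta> \<gamma> (x $ i)))) (1 / 2)"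
proof (rule penalized_least_squares_KL_half[where r' = "folded_penalty_deriv lam \<alpha> \<beta> \<gamma>"])
  \<comment> \<open>\<open>s\<close> is the sign of \<open>t\<close>; \<open>u\<close> and \<open>w\<close> tell whether \<open>\<bar>t\<bar>\<close> has passed \<open>\<beta>\<close> and \<open>\<gamma>\<close>.\<close>
  define piece where "piece = (\<lambda>(s, u, w).
    (- \<alpha> * (u * \<beta>\<^sup>2 - w * \<gamma>\<^sup>2), s * (lam + 2 * \<alpha> * (u * \<beta> - w * \<gamma>)), - 2 * \<alpha> * (u - w)))"
  show "finite (piece ` ({-1, 1} \<times> {0, 1} \<times> {0, 1}))" by simp
  show "isCont (folded_penalty lam \<alpha> \<beta> \<gamma>) t" for t
    unfolding folded_penalty_def by (intro continuous_intros)
  show "isCont (folded_penalty_deriv lam \<alpha> \<beta> \<gamma>) t" if "t \<noteq> 0" for t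
    unfolding folded_penalty_deriv_def using that by (intro continuous_intros)
  fix t :: real assume "t \<noteq> 0"
  then show "(folded_penalty lam \<alpha> \<beta> \<gamma> has_real_derivative folded_penalty_deriv lam \<alpha> \<beta> \<gamma> t) (at t)"
    by (rule folded_penalty_has_derivative)
  define u :: real where "u = (if \<bar>t\<bar> \<ge> \<beta> then 1 else 0)"
  define w :: real where "w = (if \<bar>t\<bar> \<ge> \<gamma> then 1 else 0)"
  define \<sigma> where "\<sigma> = sgn t"
  have abs: "\<bar>t\<bar> = \<sigma> * t" and \<sigma>: "\<sigma> = 1 \<or> \<sigma> = - 1"
    using \<open>t \<noteq> 0\<close> by (simp_all add: \<sigma>_def sgn_if)
  have max: "max 0 (\<bar>t\<bar> - \<beta>) = u * (\<sigma> * t - \<beta>)" "max 0 (\<bar>t\<bar> - \<gamma>) = w * (\<sigma> * t - \<gamma>)"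
    unfolding abs[symmetric] by (simp_all add: u_def w_def)
  have uw: "u = 0 \<or> u = 1" "w = 0 \<or> w = 1" by (simp_all add: u_def w_def)
  show "\<exists>(c, a, q)\<in>piece ` ({-1, 1} \<times> {0, 1} \<times> {0, 1}).
      folded_penalty lam \<alpha> \<beta> \<gamma> t = c + a * t + q / 2 * t\<^sup>2 \<and>
      folded_penalty_deriv lam \<alpha> \<beta> \<gamma> t = a + q * t"
  proof (rule bexI[of _ "piece (\<sigma>, u, w)"])
    show "piece (\<sigma>, u, w) \<in> piece ` ({-1, 1} \<times> {0, 1} \<times> {0, 1})"
      using \<sigma> uw by (intro imageI) auto
    show "case piece (\<sigma>, u, w) of (c, a, q) \<Rightarrow>
        folded_penalty lam \<alpha> \<beta> \<gamma> t = c + a * t + q / 2 * t\<^sup>2 \<and>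
        folded_penalty_deriv lam \<alpha> \<beta> \<gamma> t = a + q * t"
      unfolding folded_penalty_def folded_penalty_deriv_def max \<sigma>_def[symmetric]
      unfolding abs piece_def using \<sigma> uw
      by (auto simp: power2_eq_square algebra_simps)
  qed
qed

theorem mainTheorem12:
  fixes A :: "real ^ 'n ^ 'm" and b :: "real ^ 'm"
    and r :: "real \<Rightarrow> real" and lam \<theta> :: real
    and f :: "real ^ 'n \<Rightarrow> real"
  assumes f_def: "\<And>x. f x = 1 / 2 * (norm (A *v x - b))\<^sup>2 + (\<Sum>i\<in>UNIV. r (x $ i))"
    and lam_pos: "lam > 0"
    and r_cases: "(\<theta> > 2 \<and> r = scad lam \<theta>) \<or> (\<theta> > 0 \<and> r = mcp lam \<theta>)"
  shows "KL_function (\<lambda>x. ereal (f x)) (1 / 2)"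
proof -
  obtain \<alpha> \<beta> \<gamma> where "r = folded_penalty lam \<alpha> \<beta> \<gamma>"
    using r_cases scad_eq_folded_penalty[OF lam_pos] mcp_eq_folded_penalty[OF lam_pos] by blast
  then show ?thesis
    using folded_penalty_KL_half[of A b lam \<alpha> \<beta> \<gamma>] by (simp only: f_def)
qed

end
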